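(* Let $\partial$ be a divided difference operator corresponding to an element $\alpha\in R$, and let $\beta\in R$. The operation $$\mu_2(x,y)=xy+\beta\,\partial(x)\,\partial(y)$$ determines an associative product in $R$ if and only if one of the following conditions is satisfied: (i) the operator $\partial$ is a division operator and $\pi(\beta)=0$, where $\pi=1-\alpha\partial$; (ii) the operator $\partial$ is not a division operator and $\partial^2x\,\partial y=\partial x\,\partial^2y$ for any elements $x,y\in R$. In particular, condition (ii) is satisfied if $\partial^2=\gamma\partial$ with $\gamma\in R$. Furthermore, condition (ii) does not depend on a choice of $\beta$, i.e. $\beta$ is a parameter of a deformation that connects the original product structure in the ring $R$ to the product structure $\mu_2$.
   Context: $K$ is a commutative associative ring with unit, $R\supset K$ is a commutative associative ring with the same unit, and both are integral domains; all operators $R\to R$ are $K$-linear. It is assumed that $\bigcap_n \alpha^nR=0$ for every noninvertible $\alpha\in R$. A divided difference operator corresponding to $\alpha\in R$, where $\alpha$ is not invertible in $R$, is a $K$-linear operator $\partial:R\to R$, not identically trivial, such that $\partial(xy)=(\partial x)y+x(\partial y)-\alpha(\partial x)(\partial y)$ for all $x,y\in R$. It is a division operator (by $\alpha$) if moreover $\partial(\alpha)=1$. The condition $\partial^2=\gamma\partial$ means $\partial(\partial x)=\gamma\cdot\partial x$ for all $x\in R$.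
   Formalization: The equivalence is stated only when β ≠ 0 or ∂ is a division operator; for β = 0 and ∂ not a division operator, μ₂ is the original associative product although (ii) can fail (e.g. ∂ = d/dt on K[t], α = 0). *)

theory Defs
  imports Main
begin

definition unital_subring :: "'r::comm_ring_1 set \<Rightarrow> bool" where
  "unital_subring K \<longleftrightarrow> 1 \<in> K \<and> (\<forall>a\<in>K. \<forall>b\<in>K. a - b \<in> K \<and> a * b \<in> K)"

definition linear_over :: "'r::comm_ring_1 set \<Rightarrow> ('r \<Rightarrow> 'r) \<Rightarrow> bool" where
  "linear_over K f \<longleftrightarrow>
     (\<forall>x y. f (x + y) = f x + f y) \<and> (\<forall>c\<in>K. \<forall>x. f (c * x) = c * f x)"

text \<open>Invertibility of \<open>\<alpha>\<close> in the ring is \<open>\<alpha> dvd 1\<close>. The element \<open>\<alpha> = 0\<close> is allowed;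
  the operators are then the nonzero derivations.\<close>

definition divided_difference_operator ::
    "'r::comm_ring_1 set \<Rightarrow> 'r \<Rightarrow> ('r \<Rightarrow> 'r) \<Rightarrow> bool" where
  "divided_difference_operator K \<alpha> D \<longleftrightarrow>
     \<not> \<alpha> dvd 1 \<and> linear_over K D \<and> (\<exists>x. D x \<noteq> 0) \<and>
     (\<forall>x y. D (x * y) = D x * y + x * D y - \<alpha> * D x * D y)"

definition division_operator ::
    "'r::comm_ring_1 set \<Rightarrow> 'r \<Rightarrow> ('r \<Rightarrow> 'r) \<Rightarrow> bool" where
  "division_operator K \<alpha> D \<longleftrightarrow> divided_difference_operator K \<alpha> D \<and> D \<alpha> = 1"

definition pi_op :: "'r::comm_ring_1 \<Rightarrow> ('r \<Rightarrow> 'r) \<Rightarrow> 'r \<Rightarrow> 'r" where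
  "pi_op \<alpha> D x = x - \<alpha> * D x"

definition mu2 :: "'r::comm_ring_1 \<Rightarrow> ('r \<Rightarrow> 'r) \<Rightarrow> 'r \<Rightarrow> 'r \<Rightarrow> 'r" where
  "mu2 \<beta> D x y = x * y + \<beta> * D x * D y"

definition associative_product ::
    "'r::comm_ring_1 set \<Rightarrow> ('r \<Rightarrow> 'r \<Rightarrow> 'r) \<Rightarrow> bool" where
  "associative_product K \<mu> \<longleftrightarrow>
     (\<forall>y. linear_over K (\<lambda>x. \<mu> x y)) \<and> (\<forall>x. linear_over K (\<lambda>y. \<mu> x y)) \<and>
     (\<forall>x y z. \<mu> (\<mu> x y) z = \<mu> x (\<mu> y z))"

definition condition_i ::
    "'r::comm_ring_1 set \<Rightarrow> 'r \<Rightarrow> ('r \<Rightarrow> 'r) \<Rightarrow> 'r \<Rightarrow> bool" where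
  "condition_i K \<alpha> D \<beta> \<longleftrightarrow> division_operator K \<alpha> D \<and> pi_op \<alpha> D \<beta> = 0"

text \<open>No \<open>\<beta>\<close> occurs in this condition. Since \<open>mu2 0 D\<close> is the original product, the condition
  is not necessary for associativity at \<open>\<beta> = 0\<close>: for the derivative on \<open>K[t]\<close>, where
  \<open>\<alpha> = 0\<close>, it fails at \<open>x = t\<close>, \<open>y = t\<^sup>2\<close> in characteristic other than 2.\<close>

definition condition_ii ::
    "'r::comm_ring_1 set \<Rightarrow> 'r \<Rightarrow> ('r \<Rightarrow> 'r) \<Rightarrow> bool" where
  "condition_ii K \<alpha> D \<longleftrightarrow>
     \<not> division_operator K \<alpha> D \<and> (\<forall>x y. D (D x) * D y = D x * D (D y))"

end

theory Submission
  imports Defs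
begin

text \<open>With \<open>\<pi> = pi_op \<alpha> D\<close>, the associator of \<open>mu2 \<beta> D\<close> at \<open>x, y, z\<close> factors as
  \<open>\<beta> * \<pi> \<beta> * \<pi> (D y) * (D (D x) * D z - D x * D (D z))\<close>. The map \<open>\<pi>\<close> is multiplicative, and
  separatedness kills every set in which each element is \<open>\<alpha>\<close> times another one. Hence \<open>\<pi> (D y)\<close> is
  not identically zero, and \<open>\<pi> \<beta> = 0\<close> with \<open>\<beta> \<noteq> 0\<close> forces \<open>\<pi> \<alpha> = 0\<close>, that is, \<open>D \<alpha> = 1\<close>. Finally the
  commutation relation in (ii) excludes \<open>D \<alpha> = 1\<close>: taking \<open>y = \<alpha>\<close> there gives \<open>D (D x) = 0\<close> for all
  \<open>x\<close>, whereas \<open>D (D (\<alpha> * \<alpha>)) = D \<alpha> = 1\<close>.\<close>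

text \<open>Iterating \<open>step\<close> puts \<open>s\<close> into the ideal of every power of
  \<open>a\<close>.\<close>

lemma zero_if_divisible_within:
  fixes a :: "'r::idom"
  assumes separated: "(\<Inter>n::nat. range (\<lambda>r. a ^ n * r)) = {0}"
    and step: "\<And>s. s \<in> S \<Longrightarrow> \<exists>t\<in>S. s = a * t"
    and "s \<in> S"
  shows "s = 0"
proof -
  have "\<exists>t\<in>S. s = a ^ n * t" for n
  proof (induction n)
    case 0
    then show ?case using \<open>s \<in> S\<close> by simp
  next
    case (Suc n)
    then obtain t where "t \<in> S" "s = a ^ n * t" by blast
    moreover from step[OF \<open>t \<in> S\<close>] obtain u where "u \<in> S" "t = a * u" by blast
    ultimately have "s = a ^ Suc n * u" by (simp add: mult_ac)
    with \<open>u \<in> S\<close> show ?case by blast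
  qed
  then have "s \<in> (\<Inter>n::nat. range (\<lambda>r. a ^ n * r))" by blast
  with separated show ?thesis by blast
qed

context
  fixes K :: "'r::idom set" and \<alpha> :: 'r and D :: "'r \<Rightarrow> 'r"
  assumes ddo: "divided_difference_operator K \<alpha> D"
begin

lemma ddo_not_unit: "\<not> \<alpha> dvd 1"
  and ddo_nontrivial: "\<exists>x. D x \<noteq> 0"
  and ddo_mult: "D (x * y) = D x * y + x * D y - \<alpha> * D x * D y"
  and ddo_add: "D (x + y) = D x + D y"
  and ddo_scale: "c \<in> K \<Longrightarrow> D (c * x) = c * D x"
  using ddo unfolding divided_difference_operator_def linear_over_def by blast+

lemma ddo_zero: "D 0 = 0"
  using ddo_add[of 0 0] by (metis add_0 add_cancel_right_right)

text \<open>In a domain one factor of \<open>D 1 * (1 - \<alpha> * D 1)\<close> vanishes; were it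
  the second, \<open>D 1\<close> would invert \<open>\<alpha>\<close>.\<close>

lemma ddo_one: "D 1 = 0"
proof -
  have "D 1 * (1 - \<alpha> * D 1) = 0"
    using ddo_mult[of 1 1] by (simp add: algebra_simps)
  moreover have "1 - \<alpha> * D 1 \<noteq> 0"
    using ddo_not_unit by (metis dvd_triv_left eq_iff_diff_eq_0)
  ultimately show ?thesis by simp
qed

lemma pi_op_mult: "pi_op \<alpha> D (x * y) = pi_op \<alpha> D x * pi_op \<alpha> D y"
  unfolding pi_op_def ddo_mult by (simp add: algebra_simps)

lemma associator_mu2:
  "mu2 \<beta> D (mu2 \<beta> D x y) z - mu2 \<beta> D x (mu2 \<beta> D y z) =
     \<beta> * pi_op \<alpha> D \<beta> * pi_op \<alpha> D (D y) * (D (D x) * D z - D x * D (D z))"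
  unfolding mu2_def pi_op_def ddo_add ddo_mult by (simp add: algebra_simps)

lemma associative_mu2_iff:
  "associative_product K (mu2 \<beta> D) \<longleftrightarrow>
     (\<forall>x y z. \<beta> * pi_op \<alpha> D \<beta> * pi_op \<alpha> D (D y) * (D (D x) * D z - D x * D (D z)) = 0)"
proof -
  have "linear_over K (\<lambda>x. mu2 \<beta> D x y)" "linear_over K (\<lambda>y. mu2 \<beta> D x y)" for x y
    unfolding linear_over_def mu2_def by (simp_all add: ddo_add ddo_scale algebra_simps)
  then show ?thesis
    unfolding associative_product_def associator_mu2[symmetric] by simp
qed

lemma commuting_imp_not_division:
  assumes comm: "\<And>x y. D (D x) * D y = D x * D (D y)"
  shows "\<not> division_operator K \<alpha> D"
proof
  assume "division_operator K \<alpha> D"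
  then have "D \<alpha> = 1" by (simp add: division_operator_def)
  \<comment> \<open>The twisted Leibniz rule gives \<open>D (\<alpha> * \<alpha>) = \<alpha> +
    \<alpha> - \<alpha> = \<alpha>\<close>.\<close>
  then have "D (D (\<alpha> * \<alpha>)) = 1" by (simp add: ddo_mult)
  then show False
    using comm[of "\<alpha> * \<alpha>" \<alpha>] \<open>D \<alpha> = 1\<close> ddo_one by simp
qed

lemma condition_ii_iff: "condition_ii K \<alpha> D \<longleftrightarrow> (\<forall>x y. D (D x) * D y = D x * D (D y))"
  unfolding condition_ii_def using commuting_imp_not_division by blast

context
  assumes separated: "(\<Inter>n::nat. range (\<lambda>r. \<alpha> ^ n * r)) = {0}"
begin

lemma pi_op_ddo_nontrivial: "\<exists>y. pi_op \<alpha> D (D y) \<noteq> 0"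
proof (rule ccontr)
  assume "\<not> ?thesis"
  then have "D y = \<alpha> * D (D y)" for y by (simp add: pi_op_def)
  \<comment> \<open>The cofactor \<open>D (D y)\<close> lies in \<open>range D\<close>
    again.\<close>
  then have "D y = 0" for y
    using zero_if_divisible_within[OF separated, of "range D"] by blast
  with ddo_nontrivial show False by blast
qed

lemma division_operator_if_pi_op_zero:
  assumes "pi_op \<alpha> D \<beta> = 0" "\<beta> \<noteq> 0"
  shows "division_operator K \<alpha> D"
proof -
  have "pi_op \<alpha> D \<alpha> = 0"
  proof (rule ccontr)
    assume "pi_op \<alpha> D \<alpha> \<noteq> 0"
    \<comment> \<open>The kernel of \<pi> is closed under division by \<open>\<alpha>\<close>: the
      witness is \<open>D s\<close>, whose image under \<pi> vanishes after cancelling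
      \<open>pi_op \<alpha> D \<alpha>\<close>.\<close>
    have "\<exists>t\<in>{s. pi_op \<alpha> D s = 0}. s = \<alpha> * t" if "s \<in> {s. pi_op \<alpha> D s = 0}" for s
    proof -
      from that have s: "pi_op \<alpha> D s = 0" "s = \<alpha> * D s" by (simp_all add: pi_op_def)
      then have "pi_op \<alpha> D \<alpha> * pi_op \<alpha> D (D s) = 0"
        by (metis pi_op_mult)
      with \<open>pi_op \<alpha> D \<alpha> \<noteq> 0\<close> s show ?thesis by auto
    qed
    then have "\<beta> = 0"
      using zero_if_divisible_within[OF separated, of "{s. pi_op \<alpha> D s = 0}" \<beta>] assms(1) by blast
    with \<open>\<beta> \<noteq> 0\<close> show False ..
  qed
  \<comment> \<open>For \<open>\<alpha> = 0\<close> the map \<pi> is the identity. Otherwise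
    \<open>\<alpha>\<close> cancels in \<open>\<alpha> - \<alpha> * D \<alpha> = 0\<close>.\<close>
  moreover have "\<alpha> \<noteq> 0" using assms by (auto simp: pi_op_def)
  ultimately have "D \<alpha> = 1" by (simp add: pi_op_def)
  with ddo show ?thesis by (simp add: division_operator_def)
qed

text \<open>In a domain some factor of the associator vanishes; \<open>y\<close> occurs only in
  \<pi>(\<open>D y\<close>), so it can be fixed with this factor nonzero.\<close>

lemma associative_mu2_cases:
  "associative_product K (mu2 \<beta> D) \<longleftrightarrow> \<beta> = 0 \<or> pi_op \<alpha> D \<beta> = 0 \<or> condition_ii K \<alpha> D"
  using pi_op_ddo_nontrivial unfolding associative_mu2_iff condition_ii_iff by auto

end

end

theorem theorem2:
  fixes K :: "'r::idom set" and \<alpha> \<beta> :: 'r and D :: "'r \<Rightarrow> 'r"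
  assumes subring: "unital_subring K"
    and separated: "\<And>a::'r. \<not> a dvd 1 \<Longrightarrow> (\<Inter>n::nat. range (\<lambda>r. a ^ n * r)) = {0}"
    and ddo: "divided_difference_operator K \<alpha> D"
  shows "(\<beta> \<noteq> 0 \<or> division_operator K \<alpha> D \<longrightarrow>
            (associative_product K (mu2 \<beta> D) \<longleftrightarrow>
               condition_i K \<alpha> D \<beta> \<or> condition_ii K \<alpha> D)) \<and>
         (\<forall>\<gamma>. (\<forall>x. D (D x) = \<gamma> * D x) \<longrightarrow> condition_ii K \<alpha> D) \<and>
         (condition_ii K \<alpha> D \<longrightarrow> (\<forall>b. associative_product K (mu2 b D))) \<and>
         mu2 0 D = (*)"
proof -
  have sep: "(\<Inter>n::nat. range (\<lambda>r. \<alpha> ^ n * r)) = {0}"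
    using separated ddo_not_unit[OF ddo] by blast
  note cases = associative_mu2_cases[OF ddo sep]
  \<comment> \<open>This settles \<open>\<beta> = 0\<close> for a division operator: both sides of
    the equivalence hold.\<close>
  have "pi_op \<alpha> D 0 = 0" by (simp add: pi_op_def ddo_zero[OF ddo])
  then have "\<beta> \<noteq> 0 \<or> division_operator K \<alpha> D \<longrightarrow>
      (associative_product K (mu2 \<beta> D) \<longleftrightarrow> condition_i K \<alpha> D \<beta> \<or> condition_ii K \<alpha> D)"
    unfolding cases condition_i_def
    using division_operator_if_pi_op_zero[OF ddo sep] by blast
  moreover have "(\<forall>x. D (D x) = \<gamma> * D x) \<longrightarrow> condition_ii K \<alpha> D" for \<gamma>
    by (simp add: condition_ii_iff[OF ddo])
  moreover have "condition_ii K \<alpha> D \<longrightarrow> (\<forall>b. associative_product K (mu2 b D))"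
    by (simp add: cases)
  moreover have "mu2 0 D = (*)" by (simp add: mu2_def fun_eq_iff)
  ultimately show ?thesis by blast
qed

end
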